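(* For all $V,W\in\mathcal G(s,d)$ and all $S\in\mathbb R^{d\times d}$ with $SV\in\mathcal G(s,d)$ (i.e. $\dim SV=s$), $$|\angle(SV,W)-\angle(V,W)|\le C\|S-I_d\|,\qquad C=\frac{\pi}{2}+\Big(\frac{\pi^2}{4}+1\Big)^{1/2}.$$
   Context: $\mathcal G(s,d)$ is the Grassmannian of $s$-dimensional subspaces of $\mathbb R^d$ and $\|\cdot\|$ is the spectral norm. For $V,W\in\mathcal G(s,d)$ choose $P,Q\in\mathbb R^{d\times s}$ with orthonormal columns spanning $V$ and $W$; the principal angles $0\le\phi_1\le\dots\le\phi_s\le\pi/2$ are defined by $\cos\phi_j=\sigma_j$ where $\sigma_1\ge\dots\ge\sigma_s\ge0$ are the singular values of $P^\top Q$, and $\angle(V,W):=\phi_s$ is the maximal principal angle. *)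

theory Defs
  imports "HOL-Analysis.Analysis"
begin

text \<open>Grassmannian G(s,d): s-dimensional linear subspaces of R^d.
  Dimensions are types: d = CARD('n), s = CARD('s).\<close>
definition grassmannian :: "'s::finite itself \<Rightarrow> (real^'n) set set" where
  "grassmannian _ = {V. subspace V \<and> dim V = CARD('s)}"

text \<open>P (a d x s matrix) has orthonormal columns spanning V.\<close>
definition onb_matrix :: "(real^'n) set \<Rightarrow> real^'s^'n \<Rightarrow> bool" where
  "onb_matrix V P \<longleftrightarrow> transpose P ** P = mat 1 \<and> span (columns P) = V"

text \<open>Smallest singular value sigma_s of a square s x s matrix
  (variational form: min over unit vectors of |Mx|).\<close>
definition smin :: "real^'s^'s \<Rightarrow> real" where
  "smin M = Inf {norm (M *v x) | x. norm x = 1}"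

text \<open>Maximal principal angle phi_s = arccos sigma_s(P^T Q).\<close>
definition max_angle :: "'s::finite itself \<Rightarrow> (real^'n) set \<Rightarrow> (real^'n) set \<Rightarrow> real" where
  "max_angle _ V W =
     (let P = (SOME P :: real^'s^'n. onb_matrix V P);
          Q = (SOME Q :: real^'s^'n. onb_matrix W Q)
      in arccos (smin (transpose P ** Q)))"

end

theory Submission
  imports Defs
begin

text \<open>For a unit vector w, the quantity arccos |P^T w| is the angle between w and V, because
  |P^T w| is the largest inner product of w with a unit vector of V; the maximal principal angle
  is the largest such angle over the unit vectors w of W. A matrix S with \<parallel>S - I\<parallel> = e < 1 moves
  every unit vector v by at most e, hence turns its direction by at most (\<pi>/2) e (Jordan's
  inequality), and every unit direction in SV is the direction of such an S v. By the spherical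
  triangle inequality the angle of each w to the subspace therefore changes by at most (\<pi>/2) e,
  and this bound survives taking the supremum over w. For e \<ge> 1 the claim is trivial, both
  angles lying in [0, \<pi>/2]. So the constant \<pi>/2 already suffices.\<close>

lemma Jordan_inequality:
  assumes "0 \<le> x" "x \<le> pi / 2"
  shows "2 / pi * x \<le> sin x"
proof -
  have "concave_on {0..pi/2} sin"
    by (intro f''_le0_imp_concave[where f' = cos and f'' = "\<lambda>x. - sin x"] derivative_eq_intros)
       (auto intro!: sin_ge_zero)
  then have "(1 - 2 / pi * x) * sin 0 + 2 / pi * x * sin (pi / 2)
      \<le> sin ((1 - 2 / pi * x) *\<^sub>R 0 + (2 / pi * x) *\<^sub>R (pi / 2))"
    using assms by (intro concave_onD) (auto simp: field_simps)
  then show ?thesis by simp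
qed

lemma arccos_le_pi_half_mult_sqrt:
  assumes "0 \<le> c" "c \<le> 1"
  shows "arccos c \<le> pi / 2 * sqrt (1 - c\<^sup>2)"
proof -
  have "2 / pi * arccos c \<le> sin (arccos c)"
    using assms by (intro Jordan_inequality arccos_lbound arccos_le_pi2) auto
  also have "\<dots> = sqrt (1 - c\<^sup>2)"
    using assms by (simp add: sin_arccos)
  finally show ?thesis by (simp add: field_simps)
qed

lemma arccos_inner_sgn_le:
  fixes a y :: "'a::real_inner"
  assumes "norm a = 1" "norm (y - a) \<le> e" "e < 1"
  shows "y \<noteq> 0" "arccos (inner a (sgn y)) \<le> pi / 2 * e"
proof -
  show "y \<noteq> 0" using assms by auto
  define c where "c = inner a (sgn y)"
  have ay: "inner a y = c * norm y"
    using \<open>y \<noteq> 0\<close> by (simp add: c_def sgn_div_norm)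
  have "- e \<le> inner a (y - a)"
    using assms Cauchy_Schwarz_ineq2[of a "y - a"] by auto
  then have "1 - e \<le> inner a y"
    using assms(1) by (simp add: inner_diff_right norm_eq_1)
  then have "0 < c * norm y"
    using assms(3) ay by linarith
  then have c0: "0 \<le> c"
    by (simp add: zero_less_mult_iff)
  have c1: "c \<le> 1"
    using Cauchy_Schwarz_ineq2[of a "sgn y"] assms \<open>y \<noteq> 0\<close> by (simp add: c_def norm_sgn)
  \<comment> \<open>the distance from a to the point y = norm y * sgn y is at least the distance
    sqrt (1 - c^2) from a to the line through y\<close>
  have "1 - c\<^sup>2 \<le> 1 - c\<^sup>2 + (norm y - c)\<^sup>2"
    by simp
  also have "\<dots> = (norm y)\<^sup>2 - 2 * inner a y + (norm a)\<^sup>2"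
    using assms(1) ay by (simp add: power2_eq_square algebra_simps)
  also have "\<dots> = (norm (y - a))\<^sup>2"
    by (simp add: power2_norm_eq_inner inner_diff_left inner_diff_right inner_commute)
  also have "\<dots> \<le> e\<^sup>2"
    using assms(2) by (simp add: power_mono)
  finally have "sqrt (1 - c\<^sup>2) \<le> e"
    using assms(2) norm_ge_zero[of "y - a"] by (intro real_le_lsqrt) linarith+
  then have "pi / 2 * sqrt (1 - c\<^sup>2) \<le> pi / 2 * e"
    by (simp add: mult_left_mono)
  with arccos_le_pi_half_mult_sqrt[OF c0 c1] show "arccos c \<le> pi / 2 * e"
    by linarith
qed

lemma arccos_inner_triangle:
  fixes x y z :: "'a::real_inner"
  assumes "norm x = 1" "norm y = 1" "norm z = 1"
  shows "arccos (inner x z) \<le> arccos (inner x y) + arccos (inner y z)"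
proof -
  define a where "a = inner x y"
  define b where "b = inner y z"
  have ab: "\<bar>a\<bar> \<le> 1" "\<bar>b\<bar> \<le> 1"
    unfolding a_def b_def using Cauchy_Schwarz_ineq2[of x y] Cauchy_Schwarz_ineq2[of y z] assms
    by auto
  have xz: "\<bar>inner x z\<bar> \<le> 1"
    using Cauchy_Schwarz_ineq2[of x z] assms by auto
  show ?thesis
  proof (cases "arccos a + arccos b \<le> pi")
    case False
    have "arccos (inner x z) \<le> pi"
      using xz by (intro arccos_ubound) auto
    then show ?thesis using False by (simp add: a_def b_def)
  next
    case True
    have unit: "inner x x = 1" "inner y y = 1" "inner z z = 1"
      using assms by (simp_all add: norm_eq_1)
    \<comment> \<open>Cauchy-Schwarz for the components of x and z orthogonal to y\<close>
    have "a * b - inner x z = - inner (x - a *\<^sub>R y) (z - b *\<^sub>R y)"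
      using unit by (simp add: inner_diff_left inner_diff_right a_def b_def inner_commute)
    also have "\<dots> \<le> norm (x - a *\<^sub>R y) * norm (z - b *\<^sub>R y)"
      using Cauchy_Schwarz_ineq2[of "x - a *\<^sub>R y" "z - b *\<^sub>R y"] by linarith
    also have "\<dots> = sqrt (1 - a\<^sup>2) * sqrt (1 - b\<^sup>2)"
      using unit by (simp add: norm_eq_sqrt_inner inner_diff_left inner_diff_right a_def b_def
          inner_commute power2_eq_square)
    finally have "cos (arccos a + arccos b) \<le> inner x z"
      using ab by (simp add: cos_add sin_arccos)
    then have "arccos (inner x z) \<le> arccos (cos (arccos a + arccos b))"
      using xz by (intro arccos_le_arccos) auto
    also have "\<dots> = arccos a + arccos b"
      using True ab by (intro arccos_cos add_nonneg_nonneg arccos_lbound) auto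
    finally show ?thesis by (simp add: a_def b_def)
  qed
qed

lemma arccos_Inf_le:
  fixes f g :: "'a \<Rightarrow> real"
  assumes "D \<noteq> {}"
    and f: "\<And>x. x \<in> D \<Longrightarrow> f x \<in> {-1..1}" and g: "\<And>x. x \<in> D \<Longrightarrow> g x \<in> {-1..1}"
    and fg: "\<And>x. x \<in> D \<Longrightarrow> arccos (f x) \<le> arccos (g x) + d"
  shows "arccos (Inf (f ` D)) \<le> arccos (Inf (g ` D)) + d"
proof -
  have Inf_in: "Inf (h ` D) \<in> {-1..1}" "\<And>x. x \<in> D \<Longrightarrow> Inf (h ` D) \<le> h x"
    if "\<And>x. x \<in> D \<Longrightarrow> h x \<in> {-1..1}" for h :: "'a \<Rightarrow> real"
  proof -
    have "bdd_below (h ` D)"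
      using that by (auto intro!: bdd_belowI[of _ "-1"])
    then show "\<And>x. x \<in> D \<Longrightarrow> Inf (h ` D) \<le> h x"
      by (simp add: cINF_lower)
    with \<open>D \<noteq> {}\<close> show "Inf (h ` D) \<in> {-1..1}"
      using that by (force intro: cINF_greatest)
  qed
  define t where "t = arccos (Inf (g ` D)) + d"
  have below_t: "arccos (f x) \<le> t" if "x \<in> D" for x
  proof -
    have "arccos (g x) \<le> arccos (Inf (g ` D))"
      using Inf_in[OF g] g that by (intro arccos_le_arccos) auto
    then show ?thesis using fg[OF that] by (simp add: t_def)
  qed
  show ?thesis
  proof (cases "t < pi")
    case False
    then show ?thesis
      using Inf_in(1)[OF f] arccos_ubound[of "Inf (f ` D)"] by (simp add: t_def)
  next
    case True
    obtain x0 where "x0 \<in> D" using \<open>D \<noteq> {}\<close> by blast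
    then have "0 \<le> t"
      using below_t f by (meson arccos_lbound atLeastAtMost_iff order_trans)
    have "cos t \<le> f x" if "x \<in> D" for x
      using cos_monotone_0_pi_le[OF arccos_lbound below_t[OF that]] True f[OF that] by simp
    then have "cos t \<le> Inf (f ` D)"
      using \<open>D \<noteq> {}\<close> by (intro cINF_greatest)
    then have "arccos (Inf (f ` D)) \<le> arccos (cos t)"
      using Inf_in(1)[OF f] by (intro arccos_le_arccos) auto
    also have "\<dots> = t"
      using \<open>0 \<le> t\<close> True by (simp add: arccos_cos)
    finally show ?thesis by (simp add: t_def)
  qed
qed

definition within_angle :: "real \<Rightarrow> 'a::real_inner set \<Rightarrow> 'a set \<Rightarrow> bool" where
  "within_angle \<delta> U U' \<longleftrightarrow>
     (\<forall>u\<in>U. norm u = 1 \<longrightarrow> (\<exists>u'\<in>U'. norm u' = 1 \<and> arccos (inner u u') \<le> \<delta>))"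

lemma within_angle_image:
  fixes f :: "'a::real_inner \<Rightarrow> 'a"
  assumes f: "linear f" and V: "subspace V"
    and near_id: "\<And>x. norm (f x - x) \<le> e * norm x" and "e < 1"
  shows "within_angle (pi / 2 * e) V (f ` V)" "within_angle (pi / 2 * e) (f ` V) V"
proof -
  have turn: "f v \<noteq> 0 \<and> arccos (inner v (sgn (f v))) \<le> pi / 2 * e" if "norm v = 1" for v
    using arccos_inner_sgn_le[OF that _ \<open>e < 1\<close>] near_id[of v] that by simp
  show "within_angle (pi / 2 * e) V (f ` V)"
    unfolding within_angle_def
  proof (intro ballI impI)
    fix v assume "v \<in> V" "norm v = 1"
    have "sgn (f v) = f (inverse (norm (f v)) *\<^sub>R v)"
      by (simp add: linear_scale[OF f] sgn_div_norm)
    then have "sgn (f v) \<in> f ` V"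
      using subspace_scale[OF V \<open>v \<in> V\<close>] by (metis imageI)
    moreover have "norm (sgn (f v)) = 1"
      using turn[OF \<open>norm v = 1\<close>] by (simp add: norm_sgn)
    ultimately show "\<exists>u\<in>f ` V. norm u = 1 \<and> arccos (inner v u) \<le> pi / 2 * e"
      using turn[OF \<open>norm v = 1\<close>] by blast
  qed
  show "within_angle (pi / 2 * e) (f ` V) V"
    unfolding within_angle_def
  proof (intro ballI impI)
    fix u assume "u \<in> f ` V" "norm u = 1"
    then obtain v where "v \<in> V" and u: "u = f v" by blast
    then have "v \<noteq> 0"
      using \<open>norm u = 1\<close> linear_0[OF f] by auto
    have "sgn (f (sgn v)) = u"
      using \<open>v \<noteq> 0\<close> \<open>norm u = 1\<close>
      by (simp add: u sgn_div_norm linear_scale[OF f] sgn_scaleR[of "inverse (norm v)"])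
    moreover have "sgn v \<in> V" "norm (sgn v) = 1"
      using V \<open>v \<in> V\<close> \<open>v \<noteq> 0\<close> by (auto simp: sgn_div_norm norm_sgn intro: subspace_scale)
    ultimately show "\<exists>v'\<in>V. norm v' = 1 \<and> arccos (inner u v') \<le> pi / 2 * e"
      using turn[of "sgn v"] by (intro bexI[of _ "sgn v"]) (auto simp: inner_commute)
  qed
qed

lemma onb_matrix_exists:
  assumes "U \<in> grassmannian TYPE('s::finite)"
  shows "\<exists>P::real^'s^'n. onb_matrix U P"
proof -
  from assms have "subspace U" and dim: "dim U = CARD('s)"
    by (auto simp: grassmannian_def)
  then obtain B where B: "pairwise orthogonal B" "\<And>x. x \<in> B \<Longrightarrow> norm x = 1"
    "independent B" "card B = dim U" "span B = U"
    using orthonormal_basis_subspace by blast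
  obtain b where b: "bij_betw b (UNIV::'s set) B"
    using finite_same_card_bij[of "UNIV::'s set" B] independent_imp_finite[OF B(3)] B(4) dim
    by auto
  define P where "P = (\<chi> i j. b j $ i :: real^'s^'n)"
  have col: "column j P = b j" for j
    by (simp add: P_def column_def vec_eq_iff)
  have "inner (b i) (b j) = (if i = j then 1 else 0)" for i j
  proof (cases "i = j")
    case True
    then show ?thesis using B(2)[of "b j"] b by (auto simp: norm_eq_1 bij_betw_def)
  next
    case False
    then have "b i \<noteq> b j" using b by (auto simp: bij_betw_def inj_on_def)
    then show ?thesis using B(1) b False unfolding pairwise_def orthogonal_def bij_betw_def by auto
  qed
  then have "transpose P ** P = mat 1"
    unfolding matrix_mult_transpose_dot_column col by (simp add: vec_eq_iff mat_def)
  moreover have "columns P = B"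
    using b by (auto simp: columns_def col bij_betw_def)
  ultimately show ?thesis using B(5) unfolding onb_matrix_def by blast
qed

lemma inner_matrix_vector_mult_adjoint:
  fixes P :: "real^'s^'n"
  shows "inner (P *v x) w = inner x (transpose P *v w)"
  by (metis dot_lmul_matrix inner_commute transpose_matrix_vector)

lemma onb_matrix_norm_mult:
  fixes P :: "real^'s^'n"
  assumes "onb_matrix U P"
  shows "norm (P *v x) = norm x"
proof -
  have "inner (P *v x) (P *v x) = inner x x"
    using assms by (simp add: inner_matrix_vector_mult_adjoint matrix_vector_mul_assoc onb_matrix_def)
  then show ?thesis by (simp add: norm_eq_sqrt_inner)
qed

lemma onb_matrix_mult_in:
  fixes P :: "real^'s^'n"
  assumes "onb_matrix U P"
  shows "P *v x \<in> U"
proof -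
  have "P *v x = (\<Sum>i\<in>UNIV. x$i *\<^sub>R column i P)"
    by (simp add: matrix_mult_sum scalar_mult_eq_scaleR)
  also have "\<dots> \<in> span (columns P)"
    by (intro span_sum span_scale span_base) (auto simp: columns_def)
  finally show ?thesis using assms by (simp add: onb_matrix_def)
qed

lemma onb_matrix_mult_transpose:
  fixes P :: "real^'s^'n"
  assumes "onb_matrix U P" "u \<in> U"
  shows "P *v (transpose P *v u) = u"
proof -
  have "u \<in> span (columns P)" using assms by (simp add: onb_matrix_def)
  then show ?thesis
  proof (induct rule: span_induct)
    case base
    show ?case unfolding subspace_def
      by (auto simp del: transpose_matrix_vector
          simp add: matrix_vector_right_distrib matrix_vector_mult_scaleR)
  next
    case (step x)
    then obtain j where x: "x = column j P" by (auto simp: columns_def)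
    have "x = P *v axis j 1"
      unfolding x by (simp add: column_def matrix_vector_mult_def axis_def vec_eq_iff if_distrib
          cong: if_cong)
    moreover then have "transpose P *v x = axis j 1"
      using assms(1) by (simp add: matrix_vector_mul_assoc onb_matrix_def)
    ultimately show ?case by simp
  qed
qed

lemma inner_le_norm_transpose_onb:
  fixes P :: "real^'s^'n"
  assumes "onb_matrix U P" "u \<in> U"
  shows "inner u w \<le> norm (transpose P *v w) * norm u"
proof -
  have "inner u w = inner (transpose P *v u) (transpose P *v w)"
    using inner_matrix_vector_mult_adjoint[of P "transpose P *v u" w]
      onb_matrix_mult_transpose[OF assms] by simp
  also have "\<dots> \<le> norm (transpose P *v u) * norm (transpose P *v w)"
    by (rule norm_cauchy_schwarz)
  also have "norm (transpose P *v u) = norm u"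
    using onb_matrix_norm_mult[OF assms(1), of "transpose P *v u"]
      onb_matrix_mult_transpose[OF assms] by simp
  finally show ?thesis by (simp add: mult.commute)
qed

lemma norm_transpose_onb_attained:
  fixes P :: "real^'s^'n"
  assumes "onb_matrix U P"
  obtains u where "u \<in> U" "norm u = 1" "inner u w = norm (transpose P *v w)"
proof -
  define y where "y = transpose P *v w"
  obtain x :: "real^'s" where x: "norm x = 1" "inner x y = norm y"
  proof (cases "y = 0")
    case True
    then show ?thesis using that[of "axis undefined 1"] by simp
  next
    case False
    then show ?thesis using that[of "sgn y"]
      by (simp add: norm_sgn sgn_div_norm dot_square_norm power2_eq_square)
  qed
  then show ?thesis
    using that[of "P *v x"] onb_matrix_mult_in[OF assms] onb_matrix_norm_mult[OF assms]
      inner_matrix_vector_mult_adjoint[of P x w]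
    by (simp add: y_def)
qed

lemma norm_transpose_onb_le:
  fixes P :: "real^'s^'n"
  assumes "onb_matrix U P"
  shows "norm (transpose P *v w) \<le> norm w"
proof -
  obtain u where "norm u = 1" "inner u w = norm (transpose P *v w)"
    using norm_transpose_onb_attained[OF assms] by blast
  then show ?thesis using norm_cauchy_schwarz[of u w] by simp
qed

lemma arccos_norm_transpose_onb_le:
  fixes P P' :: "real^'s^'n"
  assumes P: "onb_matrix U P" and P': "onb_matrix U' P'"
    and near: "within_angle \<delta> U U'" and w: "norm w = 1"
  shows "arccos (norm (transpose P' *v w)) \<le> arccos (norm (transpose P *v w)) + \<delta>"
proof -
  obtain u where u: "u \<in> U" "norm u = 1" "inner u w = norm (transpose P *v w)"
    using norm_transpose_onb_attained[OF P] by blast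
  then obtain u' where u': "u' \<in> U'" "norm u' = 1" "arccos (inner u u') \<le> \<delta>"
    using near by (auto simp: within_angle_def)
  have "-1 \<le> inner u' w"
    using Cauchy_Schwarz_ineq2[of u' w] u' w by auto
  moreover have "inner u' w \<le> norm (transpose P' *v w)"
    using inner_le_norm_transpose_onb[OF P' u'(1), of w] u' by simp
  moreover have "norm (transpose P' *v w) \<le> 1"
    using norm_transpose_onb_le[OF P', of w] w by simp
  ultimately have "arccos (norm (transpose P' *v w)) \<le> arccos (inner u' w)"
    by (rule arccos_le_arccos)
  also have "\<dots> \<le> arccos (inner u' u) + arccos (inner u w)"
    using arccos_inner_triangle[OF u'(2) u(2) w] .
  finally show ?thesis
    using u(3) u'(3) by (simp add: inner_commute)
qed

lemma arccos_norm_transpose_onb_image_le: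
  fixes S :: "real^'n^'n" and P P' :: "real^'s^'n"
  assumes V: "subspace V" and P: "onb_matrix V P" and P': "onb_matrix (((*v) S) ` V) P'"
    and near_id: "\<And>x. norm (S *v x - x) \<le> e * norm x" and w: "norm w = 1"
  shows "arccos (norm (transpose P' *v w)) \<le> arccos (norm (transpose P *v w)) + pi / 2 * min e 1"
      (is ?image_le)
    and "arccos (norm (transpose P *v w)) \<le> arccos (norm (transpose P' *v w)) + pi / 2 * min e 1"
      (is ?preimage_le)
proof -
  have "?image_le \<and> ?preimage_le"
  proof (cases "e < 1")
    case True
    note near = within_angle_image[OF matrix_vector_mul_linear V near_id True]
    show ?thesis
      using arccos_norm_transpose_onb_le[OF P P' near(1) w]
        arccos_norm_transpose_onb_le[OF P' P near(2) w] True by simp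
  next
    case False
    have range: "arccos (norm (transpose Q *v w)) \<in> {0..pi/2}" if "onb_matrix U Q"
      for U and Q :: "real^'s^'n"
      using norm_transpose_onb_le[OF that, of w] w norm_ge_zero[of "transpose Q *v w"]
      unfolding atLeastAtMost_iff by (intro conjI arccos_lbound arccos_le_pi2) linarith+
    have "min e 1 = 1"
      using False by simp
    then show ?thesis
      using range[OF P] range[OF P'] by simp
  qed
  then show ?image_le ?preimage_le by auto
qed

lemma max_angle_le_add:
  assumes V: "V \<in> grassmannian TYPE('s::finite)" and V': "V' \<in> grassmannian TYPE('s)"
    and W: "W \<in> grassmannian TYPE('s)"
    and le: "\<And>(P::real^'s^'n) (P'::real^'s^'n) w.
      onb_matrix V P \<Longrightarrow> onb_matrix V' P' \<Longrightarrow> norm w = 1 \<Longrightarrow>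
      arccos (norm (transpose P' *v w)) \<le> arccos (norm (transpose P *v w)) + d"
  shows "max_angle TYPE('s) V' W \<le> max_angle TYPE('s) V W + d"
proof -
  define P where "P = (SOME P :: real^'s^'n. onb_matrix V P)"
  define P' where "P' = (SOME P :: real^'s^'n. onb_matrix V' P)"
  define Q where "Q = (SOME Q :: real^'s^'n. onb_matrix W Q)"
  have P: "onb_matrix V P" and P': "onb_matrix V' P'" and Q: "onb_matrix W Q"
    using someI_ex[OF onb_matrix_exists[OF V]] someI_ex[OF onb_matrix_exists[OF V']]
      someI_ex[OF onb_matrix_exists[OF W]] by (simp_all add: P_def P'_def Q_def)
  define D where "D = {x :: real^'s. norm x = 1}"
  have "D \<noteq> {}"
    unfolding D_def using norm_axis_1 by blast
  have unit: "norm (Q *v x) = 1" if "x \<in> D" for x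
    using onb_matrix_norm_mult[OF Q, of x] that by (simp add: D_def)
  have cosine_in: "norm (transpose R *v (Q *v x)) \<in> {-1..1}" if "onb_matrix U R" "x \<in> D"
    for U x and R :: "real^'s^'n"
    using norm_transpose_onb_le[OF that(1), of "Q *v x"] unit[OF that(2)]
      norm_ge_zero[of "transpose R *v (Q *v x)"]
    unfolding atLeastAtMost_iff by linarith
  have "arccos (Inf ((\<lambda>x. norm (transpose P' *v (Q *v x))) ` D))
      \<le> arccos (Inf ((\<lambda>x. norm (transpose P *v (Q *v x))) ` D)) + d"
    by (rule arccos_Inf_le[OF \<open>D \<noteq> {}\<close> cosine_in[OF P'] cosine_in[OF P] le[OF P P' unit]])
  then show ?thesis
    unfolding max_angle_def smin_def Let_def P_def P'_def Q_def D_def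
    by (simp add: setcompr_eq_image matrix_vector_mul_assoc)
qed

theorem lemma3p3:
  fixes V W :: "(real^'n) set" and S :: "real^'n^'n"
  assumes "V \<in> grassmannian TYPE('s::finite)"
      and "W \<in> grassmannian TYPE('s)"
      and "((*v) S) ` V \<in> grassmannian TYPE('s)"
  shows "\<bar>max_angle TYPE('s) (((*v) S) ` V) W - max_angle TYPE('s) V W\<bar>
           \<le> (pi / 2 + sqrt (pi\<^sup>2 / 4 + 1)) * onorm ((*v) (S - mat 1))"
proof -
  define e where "e = onorm ((*v) (S - mat 1))"
  have "0 \<le> e"
    unfolding e_def by (intro onorm_pos_le) simp
  have near_id: "norm (S *v x - x) \<le> e * norm x" for x
    using onorm[OF matrix_vector_mul_bounded_linear[of "S - mat 1"], of x]
    by (simp add: e_def matrix_vector_mult_diff_rdistrib)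
  have "subspace V"
    using assms(1) by (simp add: grassmannian_def)
  note angle_le = arccos_norm_transpose_onb_image_le[OF \<open>subspace V\<close> _ _ near_id]
  have "max_angle TYPE('s) (((*v) S) ` V) W \<le> max_angle TYPE('s) V W + pi / 2 * min e 1"
    by (rule max_angle_le_add[OF assms(1,3,2)], rule angle_le(1))
  moreover have "max_angle TYPE('s) V W \<le> max_angle TYPE('s) (((*v) S) ` V) W + pi / 2 * min e 1"
    by (rule max_angle_le_add[OF assms(3,1,2)], rule angle_le(2))
  moreover have "pi / 2 * min e 1 \<le> (pi / 2 + sqrt (pi\<^sup>2 / 4 + 1)) * e"
    using \<open>0 \<le> e\<close> by (intro mult_mono) auto
  ultimately show ?thesis
    unfolding e_def by linarith
qed

end
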